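(* Let $\mathbf{A}\in\mathbb{R}^{n\times n}$ be the adjacency matrix and $\mathbf{W}^{(1)},\mathbf{W}^{(2)},\dots\in\mathbb{R}^{d\times d}$ the weight matrices of a GCN with parametric ReLU activation $\sigma(t)=\max(t,at)$, $a\in(0,1)$, with random input $\mathbf{x}$ and layer-$l$ output $\mathbf{y}^{(l)}$ (both vectorized). Put $\gamma_{\mathbf{A}}=\min_j\lambda_j(\mathbf{A})$ and $\gamma_{\mathbf{W}}=\inf_{i\in\mathbb{N}^+}\min_j\lambda_j(\mathbf{W}^{(i)})$. If $a\,\gamma_{\mathbf{A}}\gamma_{\mathbf{W}}\ge 1$, then for all $l\in\mathbb{N}^+$ the information loss satisfies $\mathcal{L}(\mathbf{y}^{(l)})=0$.
   Context: $\lambda_j(\cdot)$ denotes the $j$-th singular value of a matrix. $\mathbf{A}$ is the (weighted or binary) adjacency matrix of an undirected graph on $n$ nodes. The input $\mathbf{X}\in\mathbb{R}^{n\times d}$ is a random matrix of node features; set $\mathbf{Y}^{(0)}=\mathbf{X}$. The GCN is defined layer-wise by $\mathbf{Y}^{(i+1)}=\sigma(\mathbf{A}\mathbf{Y}^{(i)}\mathbf{W}^{(i+1)})$, $i\ge 0$, with $\sigma$ applied entrywise and deterministic matrices $\mathbf{A},\mathbf{W}^{(i)}$; each layer preserves the shape $n\times d$. $\mathbf{x}$ and $\mathbf{y}^{(l)}$ are the column-stacking vectorizations of $\mathbf{X}$ and $\mathbf{Y}^{(l)}$. All random vectors have entries in finite alphabets (finite sets of reals); $\mathcal{H}$ is Shannon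 entropy. The information loss is the conditional entropy $\mathcal{L}(\mathbf{y}^{(l)})=\mathcal{H}(\mathbf{x}\mid\mathbf{y}^{(l)})$. *)

theory Defs
  imports "HOL-Probability.Information" "Jordan_Normal_Form.Char_Poly"
begin

(* A weighted undirected graph on the nodes 0, ..., n - 1: its edges are sets {i, j} of nodes
   (a self-loop is the singleton {i}), and w gives the edge weights (w = 1 on a binary graph). *)
definition graph_on :: "nat \<Rightarrow> nat set set \<Rightarrow> bool" where
  "graph_on n E \<longleftrightarrow> E \<subseteq> {{i, j} | i j. i < n \<and> j < n}"

definition adjacency_matrix :: "nat \<Rightarrow> nat set set \<Rightarrow> (nat set \<Rightarrow> real) \<Rightarrow> real mat" where
  "adjacency_matrix n E w = mat n n (\<lambda>(i, j). if {i, j} \<in> E then w {i, j} else 0)"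

(* The singular values of a square matrix, in decreasing order and repeated according to
   multiplicity: the square roots of the eigenvalues of the Gram matrix. *)
definition singular_values :: "real mat \<Rightarrow> real list" where
  "singular_values A =
     rev (sorted_list_of_multiset (image_mset sqrt (proots (char_poly (transpose_mat A * A)))))"

(* Numbered from 1. *)
definition singular_value :: "real mat \<Rightarrow> nat \<Rightarrow> real" where
  "singular_value A j = singular_values A ! (j - 1)"

definition min_singular_value :: "real mat \<Rightarrow> real" where
  "min_singular_value A = Min (singular_value A ` {1..dim_row A})"

definition param_relu :: "real \<Rightarrow> real \<Rightarrow> real" where
  "param_relu a t = max t (a * t)"

primrec gcn :: "(real \<Rightarrow> real) \<Rightarrow> real mat \<Rightarrow> (nat \<Rightarrow> real mat) \<Rightarrow> real mat \<Rightarrow> nat \<Rightarrow> real mat" where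
  "gcn \<sigma> A W X 0 = X"
| "gcn \<sigma> A W X (Suc i) = map_mat \<sigma> (A * gcn \<sigma> A W X i * W (Suc i))"

(* Column stacking: entry (i, j) goes to position j * dim_row X + i. *)
definition vectorize :: "real mat \<Rightarrow> real vec" where
  "vectorize X =
     Matrix.vec (dim_row X * dim_col X) (\<lambda>k. X $$ (k mod dim_row X, k div dim_row X))"

(* The densities in the conditional entropy are with respect to counting measures on the
   (finite) ranges of x and y, i.e. they are probability mass functions; logarithms are to base b. *)
definition (in information_space) information_loss ::
    "('a \<Rightarrow> real vec) \<Rightarrow> ('a \<Rightarrow> real vec) \<Rightarrow> real" where
  "information_loss x y =
     conditional_entropy b (count_space (x ` space M)) (count_space (y ` space M)) x y"

end

theory Submission
  imports Defs
begin

text \<open>A singular value of zero would force the product in the hypothesis to be at most zero, so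
  the adjacency matrix and all weight matrices are invertible. As the activation is
  injective too, every layer is an injective map, and by the chain rule an injective image of a
  discrete random variable leaves no conditional entropy.\<close>

section \<open>Singular values\<close>

text \<open>An eigenvector \<open>v\<close> gives k |v|^2 = |B v|^2, since the transpose of a matrix
  with real entries is its adjoint. The setting is complex so that the roots are not assumed real:
  \<open>0 \<le> k\<close> in the order on the complex numbers also says that \<open>k\<close> has
  no imaginary part.\<close>

lemma eigenvalue_gram_matrix_nonneg:
  fixes B :: "complex mat"
  assumes B: "B \<in> carrier_mat m n" and real: "map_mat conjugate B = B"
    and ev: "eigenvalue (transpose_mat B * B) k"
  shows "0 \<le> k"
proof -
  obtain v where v: "v \<in> carrier_vec n" "v \<noteq> 0\<^sub>v n"
    and kv: "(transpose_mat B * B) *\<^sub>v v = k \<cdot>\<^sub>v v"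
    using ev B unfolding eigenvalue_def eigenvector_def by auto
  have Bv: "B *\<^sub>v v \<in> carrier_vec m" using B v(1) by auto
  have BB: "conjugate (B $$ (i, j)) = B $$ (i, j)" if "i < m" "j < n" for i j
    using arg_cong[OF real, of "\<lambda>C. C $$ (i, j)"] that B by simp
  \<comment> \<open>Conjugation commutes with \<open>B\<close> because the entries of
    \<open>B\<close> are real.\<close>
  have conj: "B *\<^sub>v conjugate v = conjugate (B *\<^sub>v v)"
  proof (rule eq_vecI)
    fix i assume "i < dim_vec (conjugate (B *\<^sub>v v))"
    then have i: "i < m" using B by simp
    have "conjugate (row B i \<bullet> v) = (\<Sum>j<n. conjugate (B $$ (i, j) * v $ j))"
      using B v(1) i unfolding scalar_prod_def
      by (auto simp: lessThan_atLeast0 intro!: sum.cong)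
    also have "\<dots> = row B i \<bullet> conjugate v"
      using B v(1) i BB unfolding scalar_prod_def
      by (auto simp: lessThan_atLeast0 intro!: sum.cong)
    finally show "(B *\<^sub>v conjugate v) $ i = conjugate (B *\<^sub>v v) $ i"
      using B v(1) i by simp
  qed (use B in auto)
  have "k * (v \<bullet>c v) = (transpose_mat B *\<^sub>v (B *\<^sub>v v)) \<bullet> conjugate v"
    using v(1) kv B by (simp add: assoc_mult_mat_vec[of _ n m])
  also have "\<dots> = (B *\<^sub>v v) \<bullet> (B *\<^sub>v conjugate v)"
    by (rule transpose_vec_mult_scalar[OF B]) (use v(1) Bv in auto)
  also have "\<dots> = (B *\<^sub>v v) \<bullet>c (B *\<^sub>v v)" by (simp add: conj)
  finally have "0 \<le> k * (v \<bullet>c v)" using conjugate_square_ge_0_vec[of "B *\<^sub>v v"] by simp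
  moreover have "0 < v \<bullet>c v" using v by simp
  ultimately show ?thesis
    by (auto simp: less_eq_complex_def less_complex_def zero_le_mult_iff)
qed

text \<open>\<open>proots\<close> over the reals counts only real roots, so the length is
  \<open>n\<close> only if the characteristic polynomial of the Gram matrix splits over the reals.
  It splits over the complex numbers, where all roots are real and nonnegative, and the
  factorization descends.\<close>

lemma
  fixes A :: "real mat"
  assumes A: "A \<in> carrier_mat n n"
  shows length_singular_values: "length (singular_values A) = n"
    and singular_values_nonneg: "s \<in> set (singular_values A) \<Longrightarrow> 0 \<le> s"
proof -
  let ?G = "transpose_mat A * A" and ?c = "complex_of_real"
  let ?B = "map_mat ?c A"
  have G: "?G \<in> carrier_mat n n" using A by simp
  have GB: "map_mat ?c ?G = transpose_mat ?B * ?B"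
    using A by (simp add: of_real_hom.mat_hom_mult[of _ n n] map_mat_transpose)
  obtain as where as: "char_poly (map_mat ?c ?G) = (\<Prod>a\<leftarrow>as. [:- a, 1:])" and len: "length as = n"
    using char_poly_factorized[of "map_mat ?c ?G" n] G by auto
  have nonneg: "0 \<le> a" if "a \<in> set as" for a
  proof (rule eigenvalue_gram_matrix_nonneg)
    show "?B \<in> carrier_mat n n" using A by simp
    show "map_mat conjugate ?B = ?B" by (rule eq_matI) auto
    have "poly (char_poly (map_mat ?c ?G)) a = 0"
      unfolding as using that by (auto simp: poly_prod_list prod_list_zero_iff)
    then show "eigenvalue (transpose_mat ?B * ?B) a"
      using eigenvalue_root_char_poly[of "map_mat ?c ?G" n a] G unfolding GB[symmetric] by simp
  qed
  interpret poly_hom: map_poly_comm_ring_hom ?c ..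
  have "map_poly ?c (char_poly ?G) = (\<Prod>a\<leftarrow>as. [:- a, 1:])"
    using as of_real_hom.char_poly_hom[OF G] by metis
  \<comment> \<open>Each root is real, hence equal to its real part.\<close>
  also have "\<dots> = (\<Prod>a\<leftarrow>as. map_poly ?c [:- Re a, 1:])"
    using nonneg by (intro arg_cong[of _ _ prod_list] map_cong)
      (auto simp: less_eq_complex_def complex_eq_iff)
  also have "\<dots> = map_poly ?c (\<Prod>a\<leftarrow>as. [:- Re a, 1:])"
    by (induction as) (simp_all add: poly_hom.hom_mult del: mult_pCons_left)
  \<comment> \<open>The embedding of the reals is injective, so coefficients can be
    compared.\<close>
  finally have "char_poly ?G = (\<Prod>p\<leftarrow>map (\<lambda>a. [:- Re a, 1:]) as. p)"
    by (simp add: poly_eq_iff coeff_map_poly)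
  then have "proots (char_poly ?G) = (\<Sum>p\<leftarrow>map (\<lambda>a. [:- Re a, 1:]) as. proots p)"
    by (simp only:) (rule proots_prod_list, auto)
  also have "\<dots> = mset (map Re as)"
    by (induction as) simp_all
  finally have proots: "proots (char_poly ?G) = mset (map Re as)" .
  have mset: "mset (singular_values A) = mset (map (sqrt \<circ> Re) as)"
    unfolding singular_values_def proots by (simp add: multiset.map_comp)
  show "length (singular_values A) = n"
    using arg_cong[OF mset, of size] len by simp
  \<comment> \<open>The real \<open>sqrt\<close> is an odd function, so the sign comes from the
    roots.\<close>
  show "0 \<le> s" if "s \<in> set (singular_values A)"
    using that arg_cong[OF mset, of set_mset] nonneg by (auto simp: less_eq_complex_def)
qed

text \<open>The Gram matrix is singular along with \<open>A\<close>; a kernel vector of it is an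
  eigenvector for 0, and the square root of 0 is 0.\<close>

lemma zero_in_singular_values:
  fixes A :: "real mat"
  assumes A: "A \<in> carrier_mat n n" and det: "det A = 0"
  shows "0 \<in> set (singular_values A)"
proof -
  let ?G = "transpose_mat A * A"
  have G: "?G \<in> carrier_mat n n" using A by simp
  have "det ?G = 0" using A det by (simp add: det_mult[of _ n])
  then obtain v where v: "v \<in> carrier_vec n" "v \<noteq> 0\<^sub>v n" "?G *\<^sub>v v = 0\<^sub>v n"
    using det_0_iff_vec_prod_zero[OF G] by blast
  moreover have "0 \<cdot>\<^sub>v v = 0\<^sub>v n" using v(1) by (intro eq_vecI) auto
  ultimately have "eigenvector ?G v 0"
    using A unfolding eigenvector_def by simp
  then have "eigenvalue ?G 0" unfolding eigenvalue_def ..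
  then have "poly (char_poly ?G) 0 = 0" using eigenvalue_root_char_poly[OF G] by simp
  \<comment> \<open>\<open>proots\<close> of the zero polynomial is empty by convention.\<close>
  moreover have "char_poly ?G \<noteq> 0" using degree_monic_char_poly[OF G] by auto
  ultimately show ?thesis by (force simp: singular_values_def)
qed

text \<open>The indices 1 to \<open>n\<close> exhaust the list because its length is exactly
  \<open>n\<close>. This turns the minimum over indices into one over the set of list
  elements.\<close>

lemma singular_value_image:
  assumes "A \<in> carrier_mat n n"
  shows "singular_value A ` {1..dim_row A} = set (singular_values A)"
proof -
  have "{1..n} = Suc ` {..<n}" by (auto simp: image_Suc_lessThan)
  then show ?thesis
    using assms by (auto simp: singular_value_def set_conv_nth length_singular_values image_image)
qed

lemma min_singular_value_nonneg:
  assumes "A \<in> carrier_mat n n" "n \<ge> 1"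
  shows "0 \<le> min_singular_value A"
proof -
  \<comment> \<open>\<open>Min\<close> is meaningful only on a nonempty set, whence
    \<open>n \<ge> 1\<close>.\<close>
  have "set (singular_values A) \<noteq> {}"
    using length_singular_values[OF assms(1)] assms(2) by auto
  then show ?thesis
    unfolding min_singular_value_def singular_value_image[OF assms(1)]
    by (simp add: singular_values_nonneg[OF assms(1)])
qed

lemma det_nonzero_if_min_singular_value_pos:
  assumes "A \<in> carrier_mat n n" "0 < min_singular_value A"
  shows "det A \<noteq> 0"
proof
  assume "det A = 0"
  then have "min_singular_value A \<le> 0"
    unfolding min_singular_value_def singular_value_image[OF assms(1)]
    by (intro Min_le zero_in_singular_values[OF assms(1)]) auto
  with assms(2) show False by simp
qed

section \<open>Injectivity of the layers\<close>

lemma det_nonzero_inverse: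
  fixes A :: "'a :: field mat"
  assumes "A \<in> carrier_mat n n" "det A \<noteq> 0"
  obtains B where "B \<in> carrier_mat n n" "B * A = 1\<^sub>m n" "A * B = 1\<^sub>m n"
  using det_non_zero_imp_unit[OF assms, of "()"] unfolding Units_def ring_mat_def by auto

text \<open>Multiplying by the inverses on both sides recovers \<open>Y\<close>.\<close>

lemma inj_on_mult_mat_both:
  fixes A B :: "'a :: field mat"
  assumes A: "A \<in> carrier_mat n n" "det A \<noteq> 0" and B: "B \<in> carrier_mat d d" "det B \<noteq> 0"
  shows "inj_on (\<lambda>Y. A * Y * B) (carrier_mat n d)"
proof -
  obtain A' where A': "A' \<in> carrier_mat n n" "A' * A = 1\<^sub>m n"
    using det_nonzero_inverse[OF A] by metis
  obtain B' where B': "B' \<in> carrier_mat d d" "B * B' = 1\<^sub>m d"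
    using det_nonzero_inverse[OF B] by metis
  show ?thesis
  proof (rule inj_on_inverseI)
    fix Y :: "'a mat" assume Y: "Y \<in> carrier_mat n d"
    have "A * Y * B * B' = A * Y * (B * B')"
      by (rule assoc_mult_mat) (use A(1) B(1) B' Y in auto)
    also have "\<dots> = A * Y"
      using A(1) B' Y by simp
    finally have "A * Y * B * B' = A * Y" .
    then show "A' * (A * Y * B * B') = Y"
      using A(1) A' Y by (simp add: assoc_mult_mat[of _ n n _ n _ d, symmetric])
  qed
qed

lemma inj_map_mat:
  assumes "inj f"
  shows "inj (map_mat f)"
proof (rule injI)
  fix X Y assume eq: "map_mat f X = map_mat f Y"
  have dim: "dim_row X = dim_row Y" "dim_col X = dim_col Y"
    using arg_cong[OF eq, of dim_row] arg_cong[OF eq, of dim_col] by simp_all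
  have "X $$ (i, j) = Y $$ (i, j)" if "i < dim_row Y" "j < dim_col Y" for i j
    using arg_cong[OF eq, of "\<lambda>C. C $$ (i, j)"] that dim assms by (simp add: inj_eq)
  then show "X = Y" using dim by (intro eq_matI)
qed

text \<open>A maximum of two strictly increasing functions is strictly increasing.\<close>

lemma inj_param_relu:
  assumes "0 < a"
  shows "inj (param_relu a)"
proof (rule linorder_injI)
  fix x y :: real assume "x < y"
  moreover from this have "a * x < a * y" using assms by simp
  ultimately show "param_relu a x \<noteq> param_relu a y"
    unfolding param_relu_def by linarith
qed

lemma gcn_carrier:
  assumes "A \<in> carrier_mat n n" "\<And>i. i \<ge> 1 \<Longrightarrow> W i \<in> carrier_mat d d" "X \<in> carrier_mat n d"
  shows "gcn \<sigma> A W X l \<in> carrier_mat n d"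
  by (induction l) (use assms in \<open>auto intro!: mult_carrier_mat\<close>)

lemma inj_on_gcn:
  assumes A: "A \<in> carrier_mat n n" "det A \<noteq> 0"
    and W: "\<And>i. i \<ge> 1 \<Longrightarrow> W i \<in> carrier_mat d d" "\<And>i. i \<ge> 1 \<Longrightarrow> det (W i) \<noteq> 0"
    and \<sigma>: "inj \<sigma>"
  shows "inj_on (\<lambda>X. gcn \<sigma> A W X l) (carrier_mat n d)"
proof (induction l)
  case (Suc l)
  show ?case
  proof (rule inj_onI)
    fix X Y assume XY: "X \<in> carrier_mat n d" "Y \<in> carrier_mat n d"
      and "gcn \<sigma> A W X (Suc l) = gcn \<sigma> A W Y (Suc l)"
    then have "A * gcn \<sigma> A W X l * W (Suc l) = A * gcn \<sigma> A W Y l * W (Suc l)"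
      using inj_map_mat[OF \<sigma>] by (simp add: inj_eq)
    moreover have "inj_on (\<lambda>Y. A * Y * W (Suc l)) (carrier_mat n d)"
      using A W by (intro inj_on_mult_mat_both) auto
    \<comment> \<open>The shape of the intermediate outputs places them in the set on which the
      linear part of the layer is injective.\<close>
    ultimately have "gcn \<sigma> A W X l = gcn \<sigma> A W Y l"
      using XY gcn_carrier[OF A(1) W(1)] by (auto dest: inj_onD)
    then show "X = Y" using Suc XY by (auto dest: inj_onD)
  qed
qed simp

lemma inj_on_vectorize: "inj_on vectorize (carrier_mat n d)"
proof (rule inj_onI)
  fix X Y assume X: "X \<in> carrier_mat n d" and Y: "Y \<in> carrier_mat n d"
    and eq: "vectorize X = vectorize Y"
  show "X = Y"
  proof (rule eq_matI)
    fix i j assume ij: "i < dim_row Y" "j < dim_col Y"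
    then have i: "i < n" and j: "j < d" using Y by auto
    \<comment> \<open>The entry at \<open>(i, j)\<close> is read back from position
      \<open>j * n + i\<close>, which has to lie inside the vector.\<close>
    have "j * n + i < Suc j * n" using i by simp
    also have "\<dots> \<le> d * n" using j by (intro mult_le_mono1) simp
    finally have "j * n + i < n * d" by (simp add: mult.commute)
    then show "X $$ (i, j) = Y $$ (i, j)"
      using arg_cong[OF eq, of "\<lambda>v. v $ (j * n + i)"] X Y i by (simp add: vectorize_def)
  qed (use X Y in auto)
qed

section \<open>Information loss\<close>

text \<open>Both g(X) and the pair (g(X), f(X)) are injective images of X and so have its entropy;
  by the chain rule their difference is the conditional entropy of f(X) given g(X).\<close>

lemma (in information_space) information_loss_inj:
  assumes X: "simple_function M X"
    and f: "inj_on f (X ` space M)" and g: "inj_on g (X ` space M)"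
  shows "information_loss (\<lambda>\<omega>. f (X \<omega>)) (\<lambda>\<omega>. g (X \<omega>)) = 0"
proof -
  have fX: "simple_function M (\<lambda>\<omega>. f (X \<omega>))" and gX: "simple_function M (\<lambda>\<omega>. g (X \<omega>))"
    using simple_function_compose[OF X] by (simp_all add: comp_def)
  have "inj_on (\<lambda>x. (g x, f x)) (X ` space M)"
    using f by (auto simp: inj_on_def)
  then have "\<H>(\<lambda>\<omega>. (g (X \<omega>), f (X \<omega>))) = \<H>(\<lambda>\<omega>. g (X \<omega>))"
    using entropy_of_inj[OF X, of "\<lambda>x. (g x, f x)"] entropy_of_inj[OF X g] by (simp add: comp_def)
  then show ?thesis
    using entropy_chain_rule[OF gX fX] by (simp add: information_loss_def)
qed

theorem theorem2:
  fixes M :: "'a measure" and b :: real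
    and n d :: nat and E :: "nat set set" and w :: "nat set \<Rightarrow> real"
    and A :: "real mat" and W :: "nat \<Rightarrow> real mat" and X :: "'a \<Rightarrow> real mat" and a :: real
  assumes "information_space M b"
    and "n \<ge> 1" and "d \<ge> 1"
    and "graph_on n E" and "A = adjacency_matrix n E w"
    and "\<And>i. i \<ge> 1 \<Longrightarrow> W i \<in> carrier_mat d d"
    and "simple_function M X" and "\<And>\<omega>. \<omega> \<in> space M \<Longrightarrow> X \<omega> \<in> carrier_mat n d"
    and "0 < a" and "a < 1"
    and "a * min_singular_value A * (INF i\<in>{1..}. min_singular_value (W i)) \<ge> 1"
  shows "\<forall>l\<ge>1. information_space.information_loss M b
           (\<lambda>\<omega>. vectorize (X \<omega>)) (\<lambda>\<omega>. vectorize (gcn (param_relu a) A W (X \<omega>) l)) = 0"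
proof (intro allI impI)
  fix l :: nat
  interpret information_space M b by fact
  have A: "A \<in> carrier_mat n n" using assms(5) by (simp add: adjacency_matrix_def)
  let ?\<gamma> = "INF i\<in>{1..}. min_singular_value (W i)"
  have Anonneg: "0 \<le> a * min_singular_value A"
    using min_singular_value_nonneg[OF A] assms(2,9) by simp
  have Wnonneg: "0 \<le> min_singular_value (W i)" if "i \<ge> 1" for i
    using min_singular_value_nonneg[OF assms(6)] that assms(3) by simp
  \<comment> \<open>Otherwise the product in the hypothesis would be 0.\<close>
  have "min_singular_value A \<noteq> 0" using assms(11) by auto
  then have detA: "det A \<noteq> 0"
    using det_nonzero_if_min_singular_value_pos[OF A] min_singular_value_nonneg[OF A] assms(2)
    by simp
  \<comment> \<open>A nonnegative factor times a nonpositive infimum could not reach 1.\<close>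
  have "0 < ?\<gamma>"
    using Anonneg assms(11) by (smt (verit) mult_nonneg_nonpos)
  \<comment> \<open>The infimum of a set of reals is a lower bound only if the set is bounded below;
    here 0 is a bound.\<close>
  moreover have "?\<gamma> \<le> min_singular_value (W i)" if "i \<ge> 1" for i
    using that Wnonneg by (intro cINF_lower) (auto intro!: bdd_belowI[of _ 0])
  ultimately have detW: "det (W i) \<noteq> 0" if "i \<ge> 1" for i
    using det_nonzero_if_min_singular_value_pos[OF assms(6)] that by fastforce
  let ?F = "\<lambda>Y. gcn (param_relu a) A W Y l"
  have "inj_on ?F (carrier_mat n d)"
    using A detA assms(6) detW inj_param_relu[OF assms(9)] by (intro inj_on_gcn)
  \<comment> \<open>All outputs share the shape \<open>n\<close> by \<open>d\<close>, the shape on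
    which column stacking can be undone.\<close>
  moreover have "inj_on vectorize (?F ` carrier_mat n d)"
    by (rule inj_on_subset[OF inj_on_vectorize]) (use gcn_carrier[OF A assms(6)] in auto)
  ultimately have "inj_on (\<lambda>Y. vectorize (?F Y)) (carrier_mat n d)"
    using comp_inj_on by (fastforce simp: comp_def)
  moreover have "X ` space M \<subseteq> carrier_mat n d" using assms(8) by auto
  ultimately show "information_loss (\<lambda>\<omega>. vectorize (X \<omega>)) (\<lambda>\<omega>. vectorize (?F (X \<omega>))) = 0"
    using assms(7) inj_on_vectorize by (intro information_loss_inj) (blast intro: inj_on_subset)+
qed

end
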